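(* Let $p,q\ge 1$ be integers. Every element of $\mathrm{Aut}(D_{p,q})$ has a fixed point on $\overline{D_{p,q}}:=D_{p,q}\cup\partial D_{p,q}$.
   Context: $H_{p,q}=\begin{pmatrix}I_p&0\\0&-I_q\end{pmatrix}$ and $\cdot^H$ is the Hermitian (conjugate) transpose. The generalized ball is $D_{p,q}=\{[z]\in\mathbb P^{p+q-1}: z^HH_{p,q}z>0\}$, with boundary $\partial D_{p,q}=\{[z]: z^HH_{p,q}z=0\}$. $\mathrm{Aut}(D_{p,q})$ is the group of biholomorphic automorphisms of $D_{p,q}$. It is known that every automorphism of $D_{p,q}$ is the restriction of a projective linear map $[z]\mapsto[Az]$ with $A\in U(p,q)=\{A\in GL(p+q,\mathbb C):A^HH_{p,q}A=H_{p,q}\}$; automorphisms act on $\partial D_{p,q}$ through these projective linear maps. *)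

theory Defs
  imports "HOL-Analysis.Analysis" "HOL-Library.Complex_Order"
begin

section \<open>Complex projective space\<close>

definition cproj_rel :: "complex^'n \<Rightarrow> complex^'n \<Rightarrow> bool" where
  "cproj_rel z w \<longleftrightarrow> z \<noteq> 0 \<and> w \<noteq> 0 \<and> (\<exists>c. w = c *s z)"

lemma part_equivp_cproj_rel: "part_equivp (cproj_rel :: complex^'n \<Rightarrow> complex^'n \<Rightarrow> bool)"
proof (rule part_equivpI)
  show "\<exists>z :: complex^'n. cproj_rel z z"
    by (rule exI[of _ 1]) (auto simp: cproj_rel_def intro: exI[of _ 1])
  show "symp (cproj_rel :: complex^'n \<Rightarrow> complex^'n \<Rightarrow> bool)"
  proof (rule sympI)
    fix z w :: "complex^'n"
    assume "cproj_rel z w"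
    then obtain c where c: "z \<noteq> 0" "w \<noteq> 0" "w = c *s z"
      by (auto simp: cproj_rel_def)
    then have "z = inverse c *s w"
      by (auto simp: vector_smult_assoc)
    with c show "cproj_rel w z"
      unfolding cproj_rel_def by blast
  qed
  show "transp (cproj_rel :: complex^'n \<Rightarrow> complex^'n \<Rightarrow> bool)"
    by (rule transpI) (auto simp: cproj_rel_def)
qed

text \<open>The projective space of the complex lines in the space with coordinates indexed by \<open>'n\<close>,
  so of dimension \<open>CARD('n) - 1\<close>. The quotient map \<open>abs_cproj\<close> is meaningful on nonzero vectors
  only.\<close>

quotient_type (overloaded) 'n cproj = "complex^('n::finite)" / partial: cproj_rel
  by (rule part_equivp_cproj_rel)

abbreviation proj :: "complex^'n \<Rightarrow> 'n cproj" where
  "proj \<equiv> abs_cproj"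

lemma proj_eq_iff:
  "z \<noteq> 0 \<Longrightarrow> w \<noteq> 0 \<Longrightarrow> proj z = proj w \<longleftrightarrow> (\<exists>c. w = c *s z)"
proof -
  assume nz: "z \<noteq> 0" "w \<noteq> 0"
  have refl: "cproj_rel u u" if "u \<noteq> 0" for u :: "complex^'a"
    using that by (auto simp: cproj_rel_def intro: exI[of _ 1])
  have "cproj_rel z w \<longleftrightarrow> proj z = proj w"
    using Quotient3_rel[OF Quotient3_cproj, of z w] refl nz by blast
  with nz show ?thesis
    by (auto simp: cproj_rel_def)
qed

lemma rep_cproj_nonzero: "rep_cproj x \<noteq> 0"
  using Quotient3_rep_reflp[OF Quotient3_cproj, of x] by (auto simp: cproj_rel_def)

lemma proj_rep_cproj: "proj (rep_cproj x) = x"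
  by (rule Quotient3_abs_rep[OF Quotient3_cproj])

text \<open>The quotient topology.\<close>

instantiation cproj :: (finite) topological_space
begin

definition open_cproj :: "'a cproj set \<Rightarrow> bool" where
  "open_cproj S \<longleftrightarrow> open {z. z \<noteq> 0 \<and> proj z \<in> S}"

instance
proof
  have "{z :: complex^'a. z \<noteq> 0 \<and> proj z \<in> UNIV} = - {0}"
    by auto
  then show "open (UNIV :: 'a cproj set)"
    by (simp add: open_cproj_def open_Compl)
next
  fix S T :: "'a cproj set"
  assume "open S" "open T"
  moreover have "{z. z \<noteq> 0 \<and> proj z \<in> S \<inter> T} =
      {z. z \<noteq> 0 \<and> proj z \<in> S} \<inter> {z. z \<noteq> 0 \<and> proj z \<in> T}"
    by auto
  ultimately show "open (S \<inter> T)"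
    by (simp add: open_cproj_def open_Int)
next
  fix K :: "'a cproj set set"
  assume "\<forall>S\<in>K. open S"
  moreover have "{z. z \<noteq> 0 \<and> proj z \<in> \<Union>K} = (\<Union>S\<in>K. {z. z \<noteq> 0 \<and> proj z \<in> S})"
    by auto
  ultimately show "open (\<Union>K)"
    unfolding open_cproj_def by (simp only:) (auto intro!: open_UN)
qed

end

text \<open>The standard affine charts. \<open>cproj_chart i\<close> sends the points with nonzero \<open>i\<close>-th homogeneous
  coordinate bijectively onto the affine hyperplane \<open>{w. w $ i = 1}\<close>, a copy of the complex affine
  space of dimension \<open>CARD('n) - 1\<close>; its inverse there is \<open>proj\<close>.\<close>

definition cproj_chart_dom :: "'n \<Rightarrow> ('n::finite) cproj set" where
  "cproj_chart_dom i = {proj z | z. z $ i \<noteq> 0}"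

lift_definition cproj_chart :: "'n \<Rightarrow> ('n::finite) cproj \<Rightarrow> complex^'n" is
  "\<lambda>i z. inverse (z $ i) *s z"
  by (auto simp: cproj_rel_def vec_eq_iff)

lemma cproj_chart_proj: "z \<noteq> 0 \<Longrightarrow> cproj_chart i (proj z) = inverse (z $ i) *s z"
  by (rule cproj_chart.abs_eq) (auto simp: cproj_rel_def intro: exI[of _ 1])

lemma proj_in_cproj_chart_dom: "z \<noteq> 0 \<Longrightarrow> proj z \<in> cproj_chart_dom i \<longleftrightarrow> z $ i \<noteq> 0"
proof
  assume z: "z \<noteq> 0" and "proj z \<in> cproj_chart_dom i"
  then obtain w where w: "w $ i \<noteq> 0" "proj z = proj w"
    by (auto simp: cproj_chart_dom_def)
  then have "w \<noteq> 0"
    by auto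
  with w z obtain c where "w = c *s z"
    using proj_eq_iff by metis
  with w show "z $ i \<noteq> 0"
    by auto
qed (auto simp: cproj_chart_dom_def)

text \<open>Holomorphy of a map between vector spaces on a set \<open>T\<close>: complex (Frechet) differentiability
  at each point, relative to \<open>T\<close>. Below, \<open>T\<close> is always a relatively open subset of an affine
  hyperplane \<open>{w. w $ i = 1}\<close>, and only the values of the derivative on directions tangent to that
  hyperplane matter.\<close>

definition vec_holomorphic_on :: "(complex^'n \<Rightarrow> complex^'m) \<Rightarrow> (complex^'n) set \<Rightarrow> bool" where
  "vec_holomorphic_on F T \<longleftrightarrow>
     (\<forall>w\<in>T. \<exists>F'. (F has_derivative F') (at w within T) \<and> (\<forall>c v. F' (c *s v) = c *s F' v))"

text \<open>Intended for open \<open>\<Omega>\<close>.\<close>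

definition cproj_holomorphic_on ::
    "(('n::finite) cproj \<Rightarrow> ('m::finite) cproj) \<Rightarrow> 'n cproj set \<Rightarrow> bool" where
  "cproj_holomorphic_on f \<Omega> \<longleftrightarrow>
     continuous_on \<Omega> f \<and>
     (\<forall>i j. vec_holomorphic_on (\<lambda>w. cproj_chart j (f (proj w)))
        (cproj_chart i ` {x \<in> \<Omega>. x \<in> cproj_chart_dom i \<and> f x \<in> cproj_chart_dom j}))"

text \<open>The set of biholomorphic automorphisms of \<open>\<Omega>\<close>; the values of \<open>f\<close> outside \<open>\<Omega>\<close> are irrelevant.\<close>

definition cproj_Aut :: "('n::finite) cproj set \<Rightarrow> ('n cproj \<Rightarrow> 'n cproj) set" where
  "cproj_Aut \<Omega> = {f. bij_betw f \<Omega> \<Omega> \<and> cproj_holomorphic_on f \<Omega> \<and>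
                     cproj_holomorphic_on (inv_into \<Omega> f) \<Omega>}"

text \<open>The map \<open>[z] \<mapsto> [A z]\<close>, meaningful for invertible \<open>A\<close>.\<close>

definition cproj_map :: "complex^'n^'n \<Rightarrow> ('n::finite) cproj \<Rightarrow> 'n cproj" where
  "cproj_map A x = proj (A *v rep_cproj x)"

lemma cproj_map_proj:
  assumes "invertible A" "z \<noteq> 0"
  shows "cproj_map A (proj z) = proj (A *v z)"
proof -
  have nz: "A *v u \<noteq> 0" if "u \<noteq> 0" for u
    using that assms(1) by (metis invertible_def matrix_left_invertible_ker)
  have "proj z = proj (rep_cproj (proj z))"
    by (simp add: proj_rep_cproj)
  then obtain c where "rep_cproj (proj z) = c *s z"
    using assms(2) rep_cproj_nonzero proj_eq_iff by metis
  then have "A *v rep_cproj (proj z) = c *s (A *v z)"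
    by (simp add: vec.scale)
  then show ?thesis
    unfolding cproj_map_def
    using nz assms(2) rep_cproj_nonzero proj_eq_iff by metis
qed


section \<open>Generalized balls\<close>

text \<open>The signature \<open>(p, q)\<close> is given by two finite index types with \<open>CARD('p) = p\<close> and
  \<open>CARD('q) = q\<close>, so that \<open>p, q \<ge> 1\<close> holds automatically; the \<open>p + q\<close> coordinates are indexed by
  the sum type \<open>'p + 'q\<close>.\<close>

definition Hpq :: "complex^('p::finite + 'q::finite)^('p + 'q)" where
  "Hpq = (\<chi> i j. if i = j then (case i of Inl _ \<Rightarrow> 1 | Inr _ \<Rightarrow> - 1) else 0)"

definition hermitian_transpose :: "complex^'n^'m \<Rightarrow> complex^'m^'n" where
  "hermitian_transpose A = (\<chi> i j. cnj (A $ j $ i))"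

text \<open>\<open>hform z\<close> is \<open>z\<^sup>H H z\<close>; it is always real, cf. \<open>hform_eq\<close>.\<close>

definition hform :: "complex^('p::finite + 'q::finite) \<Rightarrow> complex" where
  "hform z = (\<Sum>i\<in>UNIV. cnj (z $ i) * (Hpq *v z) $ i)"

lemma hform_eq:
  "hform (z :: complex^('p::finite + 'q::finite)) =
     of_real ((\<Sum>i\<in>UNIV. (cmod (z $ Inl i))\<^sup>2) - (\<Sum>j\<in>UNIV. (cmod (z $ Inr j))\<^sup>2))"
proof -
  have "(Hpq *v z) $ i = (case i of Inl _ \<Rightarrow> 1 | Inr _ \<Rightarrow> - 1) * z $ i" for i
    by (simp add: Hpq_def matrix_vector_mult_def if_distrib[of "\<lambda>x. x * _"] cong: if_cong)
  then have "hform z = (\<Sum>i\<in>UNIV. (case i of Inl _ \<Rightarrow> 1 | Inr _ \<Rightarrow> - 1) * of_real ((cmod (z $ i))\<^sup>2))"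
    unfolding hform_def
    by (intro sum.cong) (auto simp: complex_norm_square mult_ac simp del: of_real_power split: sum.split)
  also have "\<dots> = (\<Sum>i\<in>(UNIV :: 'p set) <+> (UNIV :: 'q set).
      (case i of Inl _ \<Rightarrow> 1 | Inr _ \<Rightarrow> - 1) * of_real ((cmod (z $ i))\<^sup>2))"
    by simp
  also have "\<dots> = of_real ((\<Sum>i\<in>UNIV. (cmod (z $ Inl i))\<^sup>2) - (\<Sum>j\<in>UNIV. (cmod (z $ Inr j))\<^sup>2))"
    by (subst sum.Plus) (simp_all add: sum_negf del: UNIV_Plus_UNIV)
  finally show ?thesis .
qed

text \<open>The order on complex numbers is that of \<^theory>\<open>HOL-Library.Complex_Order\<close>: \<open>0 < c\<close> says
  that \<open>c\<close> is real and positive.\<close>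

definition gball :: "('p::finite + 'q::finite) cproj set" where
  "gball = {proj z | z. z \<noteq> 0 \<and> hform z > 0}"

definition gball_boundary :: "('p::finite + 'q::finite) cproj set" where
  "gball_boundary = {proj z | z. z \<noteq> 0 \<and> hform z = 0}"

lemma hform_smult: "hform (c *s z) = of_real ((cmod c)\<^sup>2) * hform z"
  unfolding hform_eq of_real_mult[symmetric]
  by (simp add: norm_mult power_mult_distrib sum_distrib_left right_diff_distrib)

lemma proj_in_gball: "z \<noteq> 0 \<Longrightarrow> proj z \<in> gball \<longleftrightarrow> hform z > 0"
proof
  assume z: "z \<noteq> 0" and "proj z \<in> gball"
  then obtain w where w: "w \<noteq> 0" "hform w > 0" "proj w = proj z"
    by (auto simp: gball_def)
  with z obtain c where c: "z = c *s w"
    using proj_eq_iff by metis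
  with z have "c \<noteq> 0"
    by auto
  with w c show "hform z > 0"
    by (simp add: hform_smult less_complex_def)
qed (auto simp: gball_def)

lemma proj_in_gball_boundary: "z \<noteq> 0 \<Longrightarrow> proj z \<in> gball_boundary \<longleftrightarrow> hform z = 0"
proof
  assume z: "z \<noteq> 0" and "proj z \<in> gball_boundary"
  then obtain w where w: "w \<noteq> 0" "hform w = 0" "proj w = proj z"
    by (auto simp: gball_boundary_def)
  with z obtain c where "z = c *s w"
    using proj_eq_iff by metis
  with w show "hform z = 0"
    by (simp add: hform_smult)
qed (auto simp: gball_boundary_def)

definition gball_closure :: "('p::finite + 'q::finite) cproj set" where
  "gball_closure = gball \<union> gball_boundary"

definition U_pq :: "(complex^('p::finite + 'q::finite)^('p + 'q)) set" where
  "U_pq = {A. invertible A \<and> hermitian_transpose A ** Hpq ** A = Hpq}"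

end

theory Submission
  imports Defs "HOL-Computational_Algebra.Fundamental_Theorem_Algebra"
begin

text \<open>
  A fixed point of \<open>[z] \<mapsto> [A z]\<close> in the closure is an eigenvector of \<open>A\<close> on which the form is
  nonnegative. Start from a vector \<open>w\<close> with positive form and a nonzero polynomial \<open>P\<close> with
  \<open>P(A) w = 0\<close>, and write \<open>P = (X - \<lambda>) Q\<close>. If \<open>v = Q(A) w\<close> is nonzero, it is an eigenvector. If
  the form is negative on \<open>v\<close>, then the orthogonal projection \<open>w'\<close> of \<open>w\<close> to the invariant
  complement of \<open>v\<close> still has positive form, and \<open>Q(A) w'\<close> is both a multiple of \<open>v\<close> and
  orthogonal to \<open>v\<close>, hence zero. So the degree of the annihilating polynomial drops until an
  eigenvector with nonnegative form appears.
\<close>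

section \<open>Polynomials in a matrix applied to a vector\<close>

definition poly_mv :: "complex poly \<Rightarrow> complex^'n^'n \<Rightarrow> complex^'n \<Rightarrow> complex^'n" where
  "poly_mv P A w = (\<Sum>i\<le>degree P. coeff P i *s (((*v) A ^^ i) w))"

text \<open>Coefficients above the degree vanish, so polynomials of different degrees can be
  compared over one common range.\<close>

lemma poly_mv_eq_sum:
  assumes "degree P \<le> n"
  shows "poly_mv P A w = (\<Sum>i\<le>n. coeff P i *s (((*v) A ^^ i) w))"
  unfolding poly_mv_def
  by (rule sum.mono_neutral_left) (use assms in \<open>auto simp: coeff_eq_0\<close>)

lemma poly_mv_add: "poly_mv (P + Q) A w = poly_mv P A w + poly_mv Q A w"
proof -
  let ?n = "max (degree P) (degree Q)"
  have "degree (P + Q) \<le> ?n"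
    by (rule degree_add_le_max)
  then show ?thesis
    by (simp add: poly_mv_eq_sum[of _ ?n] vec.scale_left_distrib sum.distrib)
qed

lemma poly_mv_smult: "poly_mv (smult c P) A w = c *s poly_mv P A w"
  by (simp add: poly_mv_eq_sum[of _ "degree P"] degree_smult_le vec.scale_sum_right)

lemma poly_mv_pCons: "poly_mv (pCons a P) A w = a *s w + A *v poly_mv P A w"
proof -
  have "degree (pCons a P) \<le> Suc (degree P)"
    by (rule degree_pCons_le)
  then show ?thesis
    by (simp add: poly_mv_eq_sum[of _ "Suc (degree P)"] sum.atMost_Suc_shift poly_mv_def[of P]
        vec.sum vec.scale
        del: sum.atMost_Suc)
qed

lemma poly_mv_0: "poly_mv 0 A w = 0"
  by (simp add: poly_mv_def)

lemma poly_mv_linear_factor: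
  "poly_mv ([:- l, 1:] * Q) A w = A *v poly_mv Q A w - l *s poly_mv Q A w"
proof -
  have "[:- l, 1:] * Q = smult (- l) Q + pCons 0 Q"
    by simp
  then show ?thesis
    by (simp only: poly_mv_add poly_mv_smult poly_mv_pCons) simp
qed

lemma poly_mv_diff_smult:
  "poly_mv P A (w - c *s v) = poly_mv P A w - c *s poly_mv P A v"
  by (induction P) (simp_all add: poly_mv_0 poly_mv_pCons vec.diff vec.scale
      vec.scale_right_diff_distrib vec.scale_right_distrib vec.scale_left_commute)

lemma poly_mv_eigenvector:
  assumes "A *v v = l *s v"
  shows "poly_mv P A v = poly P l *s v"
  by (induction P) (simp_all add: poly_mv_0 poly_mv_pCons assms vec.scale
      vec.scale_left_distrib mult.commute)

text \<open>In dimension \<open>CARD('n)\<close>, the \<open>CARD('n) + 1\<close> iterates of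
  \<open>w\<close> satisfy a linear relation, whose coefficients are those of
  \<open>P\<close>.\<close>

lemma exists_annihilating_poly:
  fixes A :: "complex^'n^'n"
  obtains P where "P \<noteq> 0" "poly_mv P A w = 0"
proof -
  let ?N = "CARD('n)"
  let ?f = "\<lambda>i. ((*v) A ^^ i) w"
  show thesis
  \<comment> \<open>Independence of a set of vectors does not see a repeated iterate. A repetition
    is treated apart and gives X^i - X^j.\<close>
  proof (cases "inj_on ?f {..?N}")
    case False
    then obtain i j where ij: "i \<noteq> j" "?f i = ?f j"
      by (auto simp: inj_on_def)
    have mono: "poly_mv (monom c k) A w = c *s ?f k" for c k
      by (simp add: poly_mv_eq_sum[of _ k] degree_monom_le if_distrib[of "\<lambda>x. x *s _"]
          cong: if_cong)
    have "coeff (monom 1 i + monom (- 1) j) i \<noteq> (0 :: complex)"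
      using ij by simp
    then have "monom 1 i + monom (- 1) j \<noteq> (0 :: complex poly)"
      by force
    moreover have "poly_mv (monom 1 i + monom (- 1) j) A w = 0"
      using ij by (simp add: poly_mv_add mono)
    ultimately show thesis
      by (rule that)
  next
    case True
    have "\<not> vec.independent (?f ` {..?N})"
    proof
      assume "vec.independent (?f ` {..?N})"
      then have "card (?f ` {..?N}) \<le> vec.dim (UNIV :: (complex^'n) set)"
        by (intro vec.independent_card_le_dim) auto
      with card_image[OF True] show False
        by (simp add: vec.dim_UNIV card_cart_basis vec.dimension_def)
    qed
    then obtain u where u: "\<exists>v\<in>?f ` {..?N}. u v \<noteq> 0" "(\<Sum>v\<in>?f ` {..?N}. u v *s v) = 0"
      by (auto simp: vec.dependent_finite)
    \<comment> \<open>The relation \<open>u\<close> is indexed by vectors; injectivity turns its sum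
      into one over exponents.\<close>
    define P where "P = (\<Sum>i\<le>?N. monom (u (?f i)) i)"
    have coeff: "coeff P i = (if i \<le> ?N then u (?f i) else 0)" for i
      by (simp add: P_def coeff_sum)
    have "degree P \<le> ?N"
      by (rule degree_le) (simp add: coeff)
    then have "poly_mv P A w = (\<Sum>i\<le>?N. u (?f i) *s ?f i)"
      by (simp add: poly_mv_eq_sum coeff)
    also have "\<dots> = 0"
      using u(2) by (simp add: sum.reindex[OF True])
    finally have "poly_mv P A w = 0" .
    moreover from u(1) obtain i where "i \<le> ?N" "u (?f i) \<noteq> 0"
      by auto
    then have "P \<noteq> 0"
      using coeff[of i] by force
    ultimately show thesis
      using that by blast
  qed
qed

section \<open>The sesquilinear form\<close>

definition hprod :: "complex^('p::finite + 'q::finite) \<Rightarrow> complex^('p + 'q) \<Rightarrow> complex" where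
  "hprod x y = (\<Sum>i\<in>UNIV. cnj (x $ i) * (Hpq *v y) $ i)"

lemma hprod_self: "hprod z z = hform z"
  by (simp add: hprod_def hform_def)

lemma hprod_add_right: "hprod x (y + z) = hprod x y + hprod x z"
  by (simp add: hprod_def vec.add algebra_simps sum.distrib)

lemma hprod_diff_right: "hprod x (y - z) = hprod x y - hprod x z"
  by (simp add: hprod_def vec.diff algebra_simps sum_subtractf)

lemma hprod_scale_right: "hprod x (c *s y) = c * hprod x y"
  by (simp add: hprod_def vec.scale sum_distrib_left algebra_simps)

lemma hprod_cnj: "cnj (hprod x y) = hprod y x"
proof -
  have "(Hpq *v y) $ i = (case i of Inl _ \<Rightarrow> 1 | Inr _ \<Rightarrow> - 1) * y $ i"
    for i and y :: "complex^('a + 'b)"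
    by (simp add: Hpq_def matrix_vector_mult_def if_distrib[of "\<lambda>x. x * _"] cong: if_cong)
  then show ?thesis
    by (auto simp: hprod_def intro!: sum.cong split: sum.split)
qed

lemma hprod_scale_left: "hprod (c *s x) y = cnj c * hprod x y"
  by (metis complex_cnj_mult hprod_cnj hprod_scale_right)

text \<open>Moves \<open>A\<close> to the other argument, where the identity defining
  \<open>U_pq\<close> applies.\<close>

lemma hprod_mult_left:
  "hprod (A *v x) y = (\<Sum>j\<in>UNIV. cnj (x $ j) * ((hermitian_transpose A ** Hpq) *v y) $ j)"
proof -
  have "hprod (A *v x) y =
      (\<Sum>i\<in>UNIV. \<Sum>j\<in>UNIV. cnj (A $ i $ j) * cnj (x $ j) * (Hpq *v y) $ i)"
    by (simp add: hprod_def matrix_vector_mult_def[of A] sum_distrib_right)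
  also have "\<dots> = (\<Sum>j\<in>UNIV. \<Sum>i\<in>UNIV. cnj (A $ i $ j) * cnj (x $ j) * (Hpq *v y) $ i)"
    by (rule sum.swap)
  also have "\<dots> = (\<Sum>j\<in>UNIV. cnj (x $ j) * (hermitian_transpose A *v (Hpq *v y)) $ j)"
    by (simp add: matrix_vector_mult_def[of "hermitian_transpose A"] sum_distrib_left)
      (simp add: hermitian_transpose_def mult_ac)
  finally show ?thesis
    by (simp add: matrix_vector_mul_assoc)
qed

lemma hprod_U_pq:
  assumes "A \<in> U_pq"
  shows "hprod (A *v x) (A *v y) = hprod x y"
proof -
  have "hermitian_transpose A ** Hpq ** A = Hpq"
    using assms by (simp add: U_pq_def)
  then show ?thesis
    by (simp add: hprod_mult_left matrix_vector_mul_assoc) (simp add: hprod_def)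
qed

section \<open>Eigenvectors with nonnegative form\<close>

lemma U_pq_mult_nonzero:
  assumes "A \<in> U_pq" "v \<noteq> 0"
  shows "A *v v \<noteq> 0"
  using assms unfolding U_pq_def
  by (metis (lifting) invertible_def matrix_left_invertible_ker mem_Collect_eq)

text \<open>The orthogonal complement of \<open>v\<close> is invariant under \<open>A\<close>: if x
  is orthogonal to \<open>v\<close>, then 0 = \<open>hprod v x\<close> =
  \<open>hprod (A *v v) (A *v x)\<close> = \<open>cnj l * hprod v (A *v x)\<close>, and
  \<open>l\<close> is nonzero because \<open>A\<close> is invertible.\<close>

lemma hprod_eigenvector_invariant:
  assumes A: "A \<in> U_pq" and v: "v \<noteq> 0" "A *v v = l *s v" and w: "hprod v w = 0"
  shows "hprod v (poly_mv P A w) = 0"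
proof (induction P)
  case 0
  show ?case
    by (simp add: poly_mv_0 hprod_def)
next
  case (pCons a P)
  have "l \<noteq> 0"
    using U_pq_mult_nonzero[OF A v(1)] v(2) by auto
  moreover have "cnj l * hprod v (A *v poly_mv P A w) = 0"
    using hprod_U_pq[OF A, of v "poly_mv P A w"] pCons.IH
    by (simp add: v(2) hprod_scale_left)
  ultimately show ?case
    by (simp add: poly_mv_pCons hprod_add_right hprod_scale_right w)
qed

lemma exists_eigenvector_hform_nonneg:
  assumes A: "A \<in> U_pq" and "P \<noteq> 0" "poly_mv P A w = 0" "hform w > 0"
  shows "\<exists>v l. v \<noteq> 0 \<and> A *v v = l *s v \<and> hform v \<ge> 0"
  using assms(2-)
proof (induction "degree P" arbitrary: P w)
  \<comment> \<open>A nonzero constant annihilates only the zero vector, whose form is not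
    positive.\<close>
  case 0
  then obtain a where a: "P = [:a:]" "a \<noteq> 0"
    by (metis degree_eq_zeroE pCons_eq_0_iff)
  then have "w = 0"
    using 0 by (simp add: poly_mv_pCons poly_mv_0)
  with 0 show ?case
    by (simp add: hform_def)
next
  case (Suc n)
  then have "\<not> constant (poly P)"
    by (simp add: constant_degree)
  then obtain l where "poly P l = 0"
    using fundamental_theorem_of_algebra by blast
  then obtain Q where P: "P = [:- l, 1:] * Q"
    by (auto simp: poly_eq_0_iff_dvd)
  with Suc have Q: "Q \<noteq> 0" "n = degree Q"
    by (auto simp: degree_mult_eq simp del: mult_pCons_left)
  define v where "v = poly_mv Q A w"
  have ev: "A *v v = l *s v"
    using Suc.prems(2) by (simp add: P poly_mv_linear_factor v_def del: mult_pCons_left)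
  show ?case
  proof (cases "v = 0 \<or> hform v \<ge> 0")
    \<comment> \<open>If \<open>v = 0\<close>, then \<open>Q\<close> already annihilates
      \<open>w\<close> and has smaller degree; otherwise \<open>v\<close> is the required
      eigenvector.\<close>
    case True
    with ev Suc.hyps(1)[OF Q(2,1) _ Suc.prems(3)] show ?thesis
      unfolding v_def by blast
  next
    case False
    obtain r where r: "hform v = of_real r"
      using hform_eq by blast
    with False have v: "v \<noteq> 0" "r < 0"
      by (auto simp: less_eq_complex_def)
    \<comment> \<open>The coefficient of the orthogonal projection of \<open>w\<close> to the line
      of \<open>v\<close>.\<close>
    define c where "c = hprod v w / hform v"
    define w' where "w' = w - c *s v"
    have orth: "hprod v w' = 0"
      using v r by (simp add: w'_def hprod_diff_right hprod_scale_right hprod_self c_def)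
    have "hprod w' v = 0"
      using hprod_cnj[of v w'] orth by simp
    \<comment> \<open>By orthogonality, passing to \<open>w'\<close> subtracts
      |\<open>hprod v w\<close>|^2 / \<open>r\<close> from the form. Since \<open>r < 0\<close>, the
      form does not decrease.\<close>
    then have "hform w' = hprod w' w"
      using hprod_diff_right[of w' w "c *s v"]
      by (simp add: hprod_self hprod_scale_right flip: w'_def)
    also have "\<dots> = cnj (hprod w w')"
      by (simp add: hprod_cnj)
    also have "\<dots> = hform w - cnj c * hprod v w"
      by (simp add: w'_def hprod_diff_right hprod_scale_right hprod_cnj hprod_self[symmetric])
    also have "cnj c * hprod v w = of_real ((cmod (hprod v w))\<^sup>2 / r)"
      using complex_norm_square[of "hprod v w"] by (simp add: c_def r mult.commute)
    finally have "hform w' = hform w - of_real ((cmod (hprod v w))\<^sup>2 / r)" .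
    moreover have "(cmod (hprod v w))\<^sup>2 / r \<le> 0"
      using v by (simp add: divide_nonneg_neg)
    ultimately have pos: "hform w' > 0"
      using Suc.prems(3) by (simp add: less_complex_def)
    have "hprod v (poly_mv Q A w') = 0"
      by (rule hprod_eigenvector_invariant[OF A v(1) ev orth])
    \<comment> \<open>Here Q(A) sends \<open>w\<close> to \<open>v\<close>, and \<open>v\<close> to
      Q(l) \<open>v\<close>.\<close>
    moreover have mult: "poly_mv Q A w' = (1 - c * poly Q l) *s v"
      by (simp add: w'_def poly_mv_diff_smult poly_mv_eigenvector[OF ev] v_def[symmetric]
          vec.scale_left_diff_distrib)
    ultimately have "(1 - c * poly Q l) * hprod v v = 0"
      by (simp only: hprod_scale_right)
    with v r have "1 - c * poly Q l = 0"
      by (simp add: hprod_self)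
    with mult have "poly_mv Q A w' = 0"
      by simp
    with Suc.hyps(1)[OF Q(2,1) _ pos] show ?thesis
      by blast
  qed
qed

theorem theorem3p6:
  fixes f :: "('p::finite + 'q::finite) cproj \<Rightarrow> ('p + 'q) cproj"
    and A :: "complex^('p + 'q)^('p + 'q)"
  assumes "f \<in> cproj_Aut gball"
    and "A \<in> U_pq"
    and "\<forall>x\<in>gball. f x = cproj_map A x"
  shows "\<exists>x\<in>gball_closure. cproj_map A x = x"
proof -
  \<comment> \<open>A basis vector of the positive block; \<open>undefined\<close> is an arbitrary
    index in \<open>'p\<close>.\<close>
  let ?w = "axis (Inl undefined) 1 :: complex^('p + 'q)"
  have "(\<Sum>i\<in>UNIV. (cmod (?w $ Inl i))\<^sup>2) = (\<Sum>i\<in>UNIV. if i = (undefined :: 'p) then 1 else 0)"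
    by (rule sum.cong) (auto simp: axis_def)
  then have "hform ?w > 0"
    by (simp add: hform_eq axis_def less_complex_def)
  moreover obtain P where "P \<noteq> 0" "poly_mv P A ?w = 0"
    by (rule exists_annihilating_poly)
  ultimately obtain v l where v: "v \<noteq> 0" "A *v v = l *s v" "hform v \<ge> 0"
    using exists_eigenvector_hform_nonneg[OF assms(2)] by blast
  have "proj v \<in> gball_closure"
    using v by (auto simp: gball_closure_def proj_in_gball proj_in_gball_boundary order_le_less)
  moreover have "proj (A *v v) = proj v"
    using v U_pq_mult_nonzero[OF assms(2) v(1)] proj_eq_iff by metis
  then have "cproj_map A (proj v) = proj v"
    using assms(2) v(1) by (simp add: U_pq_def cproj_map_proj)
  ultimately show ?thesis
    by blast
qed

end
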